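(* Let $d\ge 1$, $n\ge 1$, and let $\xi_1,\dots,\xi_n$ be independent identically distributed random vectors in $\mathbb{R}^d$ whose distribution is centrally symmetric (i.e. $\xi_1\stackrel{d}{=}-\xi_1$) and satisfies $\mathbb{P}[\xi_1\in H]=0$ for every affine hyperplane $H\subset\mathbb{R}^d$. Let $S_k=\xi_1+\dots+\xi_k$ for $1\le k\le n$. Then $$\mathbb{P}[0\notin \mathrm{Conv}(S_1,S_2,\dots,S_n)]=\frac{2}{2^n n!}\sum_{k=1}^{\lceil d/2\rceil} B(n,d-2k+1),$$ where $B(n,k)$ are the coefficients defined by $(t+1)(t+3)\cdots(t+2n-1)=\sum_{k=0}^n B(n,k)t^k$ (with $B(n,k)=0$ for $k\notin\{0,\dots,n\}$).
   Context: $\mathrm{Conv}$ denotes the convex hull. *)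

theory Defs
  imports "HOL-Probability.Probability" "HOL-Computational_Algebra.Polynomial"
begin

definition B_coeff :: "nat \<Rightarrow> int \<Rightarrow> real" where
  "B_coeff n k = (if k < 0 then 0
     else coeff (\<Prod>j\<in>{1..n}. [: real (2 * j - 1), 1 :]) (nat k))"

end

(*
  0 lies in the convex hull of S_1, ..., S_n iff sum l_i x_i = 0 for some nonzero l_1 >= ... >= l_n >= 0.
  By symmetry and exchangeability the probability equals the expected proportion of signed permutations of
  (xi_1, ..., xi_n) whose prefix sums avoid 0, and almost surely this proportion is a constant.
  More generally, replace 0 by a subspace U of codimension c, and single out one vector x outside U. Fix a
  signed permutation ys of the other n - 1 vectors and insert +x or -x in all 2n possible ways. The number
  of resulting sequences that avoid U is the number of those obtained from ys by adding +x or -x to one of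
  its entries, plus one if ys avoids U, plus one if ys avoids U + span x. Summed over ys this is the recursion
  N(n, c) = N(n - 1, c - 1) + (2n - 1) N(n - 1, c), which 2 (B(n, c - 1) + B(n, c - 3) + ...) satisfies too.
*)
theory Submission
  imports Defs
begin

section \<open>Signed permutations\<close>

definition insert_at :: "nat \<Rightarrow> 'a \<Rightarrow> 'a list \<Rightarrow> 'a list" where
  "insert_at p x ys = take p ys @ x # drop p ys"

lemma length_insert_at [simp]: "length (insert_at p x ys) = Suc (length ys)"
  by (simp add: insert_at_def)

lemma nth_insert_at:
  assumes "p \<le> length ys" "i \<le> length ys"
  shows "insert_at p x ys ! i = (if i < p then ys ! i else if i = p then x else ys ! (i - 1))"
  using assms by (auto simp: insert_at_def nth_append min_def nth_Cons')

lemma map_insert_at: "map f (insert_at p x ys) = insert_at p (f x) (map f ys)"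
  by (simp add: insert_at_def take_map drop_map)

lemma insert_at_update_same:
  "p \<le> length ys \<Longrightarrow> (insert_at p y ys)[p := z] = insert_at p z ys"
  by (auto intro!: nth_equalityI simp: nth_insert_at nth_list_update)

lemma insert_at_update_other:
  "p \<le> length ys \<Longrightarrow> i < length ys \<Longrightarrow>
    (insert_at p y ys)[if i < p then i else Suc i := z] = insert_at p y (ys[i := z])"
  by (auto intro!: nth_equalityI simp: nth_insert_at nth_list_update)

lemma sum_lessThan_Suc_remove:
  fixes g :: "nat \<Rightarrow> 'b::comm_monoid_add"
  assumes "p \<le> m"
  shows "(\<Sum>i<Suc m. g i) = g p + (\<Sum>i<m. g (if i < p then i else Suc i))"
proof -
  have "(\<Sum>i<Suc m. g i) = g p + sum g ({..<Suc m} - {p})"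
    using assms by (intro sum.remove) auto
  also have "sum g ({..<Suc m} - {p}) = (\<Sum>i<m. g (if i < p then i else Suc i))"
    by (rule sum.reindex_bij_witness[where i="\<lambda>i. if i < p then i else Suc i"
          and j="\<lambda>i. if i < p then i else i - 1"]) (use assms in auto)
  finally show ?thesis .
qed

definition insert_sum :: "'a::ab_group_add \<Rightarrow> ('a list \<Rightarrow> real) \<Rightarrow> 'a list \<Rightarrow> real" where
  "insert_sum x F ys = (\<Sum>p\<le>length ys. F (insert_at p x ys) + F (insert_at p (- x) ys))"

definition merge_sum :: "'a::ab_group_add \<Rightarrow> ('a list \<Rightarrow> real) \<Rightarrow> 'a list \<Rightarrow> real" where
  "merge_sum x F ys = (\<Sum>i<length ys. F (ys[i := ys ! i + x]) + F (ys[i := ys ! i - x]))"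

text \<open>Each signed permutation of \<open>x # xs\<close> arises from exactly one signed
  permutation of \<open>xs\<close> by inserting \<open>x\<close> or \<open>- x\<close> in one slot.
  Moving this insertion into the summand makes the sum over all signed permutations a plain
  recursion on the list.\<close>

fun signed_perm_sum :: "('a::ab_group_add list \<Rightarrow> real) \<Rightarrow> 'a list \<Rightarrow> real" where
  "signed_perm_sum F [] = F []"
| "signed_perm_sum F (x # xs) = signed_perm_sum (insert_sum x F) xs"

lemma signed_perm_sum_cong:
  assumes "\<And>ys. length ys = length xs \<Longrightarrow> F ys = G ys"
  shows "signed_perm_sum F xs = signed_perm_sum G xs"
  using assms
proof (induction xs arbitrary: F G)
  case (Cons x xs)
  have "signed_perm_sum (insert_sum x F) xs = signed_perm_sum (insert_sum x G) xs"
    by (rule Cons.IH) (auto simp: insert_sum_def intro!: sum.cong Cons.prems arg_cong2[where f="(+)"])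
  then show ?case by simp
qed simp

lemma signed_perm_sum_add:
  "signed_perm_sum (\<lambda>ys. F ys + G ys) xs = signed_perm_sum F xs + signed_perm_sum G xs"
proof (induction xs arbitrary: F G)
  case (Cons x xs)
  have "insert_sum x (\<lambda>ys. F ys + G ys) = (\<lambda>ys. insert_sum x F ys + insert_sum x G ys)"
    by (auto simp: insert_sum_def sum.distrib algebra_simps)
  then show ?case by (simp add: Cons.IH)
qed simp

lemma signed_perm_sum_const:
  "signed_perm_sum (\<lambda>_. c) xs = c * (2 ^ length xs * fact (length xs))"
proof (induction xs arbitrary: c)
  case (Cons x xs)
  have "signed_perm_sum (\<lambda>_. c) (x # xs) =
      signed_perm_sum (\<lambda>_. c * (2 * Suc (length xs))) xs"
    by (auto simp: insert_sum_def intro!: signed_perm_sum_cong)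
  then show ?case by (simp add: Cons.IH algebra_simps)
qed simp

text \<open>A product rule: \<open>x\<close> is merged either into an old entry, which commutes with
  inserting \<open>y\<close>, or into the new entry, which amounts to inserting \<open>y + x\<close>
  or \<open>y - x\<close> with either sign.\<close>

lemma insert_sum_merge_sum:
  "insert_sum y (merge_sum x F) ys =
     insert_sum (y + x) F ys + insert_sum (y - x) F ys + merge_sum x (insert_sum y F) ys"
proof -
  define mg where "mg z p = (\<Sum>i<length ys. F (insert_at p z (ys[i := ys ! i + x]))
      + F (insert_at p z (ys[i := ys ! i - x])))" for z p
  have *: "merge_sum x F (insert_at p z ys) =
      F (insert_at p (z + x) ys) + F (insert_at p (z - x) ys) + mg z p"
    if "p \<le> length ys" for p z
  proof -
    have "merge_sum x F (insert_at p z ys) = (\<Sum>i<Suc (length ys).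
        F ((insert_at p z ys)[i := insert_at p z ys ! i + x])
        + F ((insert_at p z ys)[i := insert_at p z ys ! i - x]))"
      by (simp add: merge_sum_def)
    also have "\<dots> = F (insert_at p (z + x) ys) + F (insert_at p (z - x) ys)
        + (\<Sum>i<length ys. 
        F ((insert_at p z ys)[if i < p then i else Suc i := ys ! i + x])
        + F ((insert_at p z ys)[if i < p then i else Suc i := ys ! i - x]))"
      using that
      by (subst sum_lessThan_Suc_remove[OF that], intro arg_cong2[where f="(+)"] sum.cong)
        (auto simp: nth_insert_at insert_at_update_same)
    also have "(\<Sum>i<length ys. 
        F ((insert_at p z ys)[if i < p then i else Suc i := ys ! i + x])
        + F ((insert_at p z ys)[if i < p then i else Suc i := ys ! i - x])) = mg z p"
      unfolding mg_def using that by (intro sum.cong refl) (simp only: insert_at_update_other lessThan_iff)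
    finally show ?thesis .
  qed
  have "insert_sum y (merge_sum x F) ys = (\<Sum>p\<le>length ys.
      (F (insert_at p (y + x) ys) + F (insert_at p (y - x) ys) + mg y p)
      + (F (insert_at p (- y + x) ys) + F (insert_at p (- y - x) ys) + mg (- y) p))"
    unfolding insert_sum_def by (intro sum.cong refl) (simp add: *)
  also have "\<dots> = insert_sum (y + x) F ys + insert_sum (y - x) F ys
      + ((\<Sum>p\<le>length ys. mg y p) + (\<Sum>p\<le>length ys. mg (- y) p))"
  proof -
    have e: "- y + x = - (y - x)" "- y - x = - (y + x)" by simp_all
    show ?thesis unfolding e insert_sum_def sum.distrib by (simp only: add_ac)
  qed
  also have "(\<Sum>p\<le>length ys. mg y p) + (\<Sum>p\<le>length ys. mg (- y) p) = merge_sum x (insert_sum y F) ys"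
    unfolding mg_def merge_sum_def insert_sum_def
    by (subst (1 2) sum.swap) (simp add: sum.distrib algebra_simps)
  finally show ?thesis .
qed

text \<open>Merging plus or minus \<open>x\<close> into an entry after permuting and changing signs
  is the same as doing so before. The merged terms thus become signed permutation sums of lists as
  long as \<open>xs\<close>, to which an induction on length applies.\<close>

lemma signed_perm_sum_merge_sum:
  "signed_perm_sum (merge_sum x F) xs = merge_sum x (signed_perm_sum F) xs"
proof (induction xs arbitrary: F)
  case Nil
  then show ?case by (simp add: merge_sum_def)
next
  case (Cons y xs)
  have "insert_sum y (merge_sum x F) =
     (\<lambda>ys. insert_sum (y + x) F ys + insert_sum (y - x) F ys + merge_sum x (insert_sum y F) ys)"
    by (auto simp: insert_sum_merge_sum)
  then have "signed_perm_sum (merge_sum x F) (y # xs) =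
      signed_perm_sum (insert_sum (y + x) F) xs + signed_perm_sum (insert_sum (y - x) F) xs
      + merge_sum x (signed_perm_sum (insert_sum y F)) xs"
    by (simp add: signed_perm_sum_add Cons.IH)
  also have "\<dots> = merge_sum x (signed_perm_sum F) (y # xs)"
    by (simp add: merge_sum_def sum.lessThan_Suc_shift del: sum.lessThan_Suc)
  finally show ?case .
qed

text \<open>One list \<open>L\<close> of signed index sequences serves all \<open>X\<close> and
  \<open>F\<close>. Applied to random vectors it is independent of the outcome, so expectations can
  be taken term by term.\<close>

lemma signed_perm_sum_eq_sum_list:
  fixes js :: "'b list"
  assumes "distinct js"
  shows "\<exists>L :: (real \<times> 'b) list list.
    (\<forall>(X :: 'b \<Rightarrow> 'v::real_vector) F. signed_perm_sum F (map X js) =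
        (\<Sum>ps\<leftarrow>L. F (map (\<lambda>(s, j). s *\<^sub>R X j) ps))) \<and>
    (\<forall>ps\<in>set L. distinct (map snd ps) \<and> set (map snd ps) = set js \<and>
        fst ` set ps \<subseteq> {1, -1})"
  using assms
proof (induction js)
  case Nil
  then show ?case by (intro exI[of _ "[[]]"]) auto
next
  case (Cons j js)
  from Cons obtain L :: "(real \<times> 'b) list list" where
    L1: "\<And>(X :: 'b \<Rightarrow> 'v) F. signed_perm_sum F (map X js) =
        (\<Sum>ps\<leftarrow>L. F (map (\<lambda>(s, j). s *\<^sub>R X j) ps))" and
    L2: "\<And>ps. ps \<in> set L \<Longrightarrow> distinct (map snd ps) \<and> set (map snd ps) = set js \<and>
        fst ` set ps \<subseteq> {1, -1}" by auto
  define L' where "L' = concat (map (\<lambda>ps. concat (map (\<lambda>q.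
      [insert_at q (1, j) ps, insert_at q (-1, j) ps]) [0..<Suc (length ps)])) L)"
  have "signed_perm_sum F (map X (j # js)) =
      (\<Sum>ps\<leftarrow>L'. F (map (\<lambda>(s, j). s *\<^sub>R X j) ps))" for X :: "'b \<Rightarrow> 'v" and F
  proof -
    have "signed_perm_sum F (map X (j # js)) =
        (\<Sum>ps\<leftarrow>L. insert_sum (X j) F (map (\<lambda>(s, j). s *\<^sub>R X j) ps))"
      by (simp add: L1)
    also have "\<dots> = (\<Sum>ps\<leftarrow>L. \<Sum>q\<leftarrow>[0..<Suc (length ps)].
        F (map (\<lambda>(s, j). s *\<^sub>R X j) (insert_at q (1, j) ps))
        + F (map (\<lambda>(s, j). s *\<^sub>R X j) (insert_at q (-1, j) ps)))"
      by (simp add: insert_sum_def map_insert_at interv_sum_list_conv_sum_set_nat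
          atLeast0LessThan lessThan_Suc_atMost del: upt_Suc)
    also have "\<dots> = (\<Sum>ps\<leftarrow>L'. F (map (\<lambda>(s, j). s *\<^sub>R X j) ps))"
    proof -
      have *: "(\<Sum>x\<leftarrow>concat (map h ls). G x) = (\<Sum>l\<leftarrow>ls. \<Sum>x\<leftarrow>h l. G x)"
        for h :: "'x \<Rightarrow> 'y list" and ls and G :: "'y \<Rightarrow> real"
        by (induction ls) auto
      show ?thesis unfolding L'_def by (simp only: *) simp
    qed
    finally show ?thesis .
  qed
  moreover have "distinct (map snd ps) \<and> set (map snd ps) = set (j # js) \<and> fst ` set ps \<subseteq> {1, -1}"
    if "ps \<in> set L'" for ps
  proof -
    from that obtain qs q s where *: "qs \<in> set L" "ps = insert_at q (s, j) qs" "s = 1 \<or> s = -1"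
      by (auto simp: L'_def)
    have "mset ps = mset ((s, j) # qs)"
    proof -
      have "mset ps = add_mset (s, j) (mset (take q qs @ drop q qs))"
        using *(2) by (simp only: insert_at_def mset_append mset.simps) simp
      then show ?thesis by simp
    qed
    then have "set ps = set ((s, j) # qs)" "mset (map snd ps) = mset (map snd ((s, j) # qs))"
      by (metis mset_eq_setD, metis mset_map)
    moreover have "distinct (map snd ((s, j) # qs))"
      using L2[OF *(1)] Cons.prems by auto
    ultimately show ?thesis
      using L2[OF *(1)] *(3) mset_eq_imp_distinct_iff[of "map snd ps" "map snd ((s, j) # qs)"] by auto
  qed
  ultimately show ?case by blast
qed

section \<open>Decreasing weights and insertion of a vector\<close>

definition lin_comb :: "(nat \<Rightarrow> real) \<Rightarrow> 'v::real_vector list \<Rightarrow> 'v" where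
  "lin_comb l ys = (\<Sum>i<length ys. l i *\<^sub>R ys ! i)"

text \<open>Weights live on all naturals and vanish from \<open>m\<close> on. Monotonicity then
  forces them to be nonnegative, \<open>l 0 > 0\<close> says that they are not all zero, and
  \<open>l m = 0\<close> acts as a last breakpoint.\<close>

definition weights :: "nat \<Rightarrow> (nat \<Rightarrow> real) set" where
  "weights m = {l. antimono l \<and> (\<forall>i\<ge>m. l i = 0) \<and> l 0 > 0}"

text \<open>
  Summation by parts turns a nontrivial nonnegative combination of the prefix sums of \<open>ys\<close> into
  a combination of \<open>ys\<close> itself with nonincreasing nonnegative weights, so \<open>meets U ys\<close> says that
  the convex hull of the prefix sums meets the subspace \<open>U\<close>.
\<close>

definition meets :: "'v::real_vector set \<Rightarrow> 'v list \<Rightarrow> bool" where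
  "meets U ys \<longleftrightarrow> (\<exists>l\<in>weights (length ys). lin_comb l ys \<in> U)"

text \<open>A convex cone recording the coefficient \<open>t\<close> of \<open>x\<close> before
  \<open>x\<close> has a place in the list; where \<open>t\<close> lies among the values of
  \<open>l\<close> decides the slots that \<open>x\<close> may take.\<close>

definition ext_cone :: "'v::real_vector set \<Rightarrow> 'v \<Rightarrow> 'v list \<Rightarrow> ((nat \<Rightarrow> real) \<times> real) set" where
  "ext_cone U x ys = {(l, t). l \<in> weights (length ys) \<and> lin_comb l ys + t *\<^sub>R x \<in> U}"

lemma lin_comb_insert_at:
  assumes "p \<le> length ys"
  shows "lin_comb l (insert_at p x ys) = lin_comb (\<lambda>i. l (if i < p then i else Suc i)) ys + l p *\<^sub>R x"
proof -
  have "lin_comb l (insert_at p x ys) = (\<Sum>i<Suc (length ys). l i *\<^sub>R insert_at p x ys ! i)"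
    by (simp add: lin_comb_def)
  also have "\<dots> = l p *\<^sub>R x + (\<Sum>i<length ys. l (if i < p then i else Suc i) *\<^sub>R ys ! i)"
    by (subst sum_lessThan_Suc_remove[OF assms], intro arg_cong2[where f="(+)"] sum.cong)
      (use assms in \<open>auto simp: nth_insert_at\<close>)
  finally show ?thesis by (simp add: lin_comb_def)
qed

lemma lin_comb_update:
  assumes "i < length ys"
  shows "lin_comb l (ys[i := ys ! i + x]) = lin_comb l ys + l i *\<^sub>R x"
proof -
  have "lin_comb l (ys[i := ys ! i + x]) = (\<Sum>j<length ys. l j *\<^sub>R ys ! j + (if j = i then l i *\<^sub>R x else 0))"
    unfolding lin_comb_def by (auto intro!: sum.cong simp: nth_list_update algebra_simps)
  then show ?thesis using assms by (simp add: sum.distrib lin_comb_def)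
qed

lemma weights_combine:
  assumes "l \<in> weights m" "l' \<in> weights m" "a > 0" "b > 0"
  shows "(\<lambda>i. a * l i + b * l' i) \<in> weights m"
  using assms
  by (auto simp: weights_def intro!: antimonoI add_mono mult_left_mono add_pos_pos intro: antimonoD)

lemma lin_comb_combine: "lin_comb (\<lambda>i. a * l i + b * l' i) ys = a *\<^sub>R lin_comb l ys + b *\<^sub>R lin_comb l' ys"
  by (simp add: lin_comb_def scaleR_sum_right sum.distrib algebra_simps)

lemma ext_cone_combine:
  assumes "subspace U" "(l, t) \<in> ext_cone U x ys" "(l', t') \<in> ext_cone U x ys" "a > 0" "b > 0"
  shows "((\<lambda>i. a * l i + b * l' i), a * t + b * t') \<in> ext_cone U x ys"
proof -
  have "a *\<^sub>R (lin_comb l ys + t *\<^sub>R x) + b *\<^sub>R (lin_comb l' ys + t' *\<^sub>R x) \<in> U"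
    using assms by (auto simp: ext_cone_def intro!: subspace_add subspace_mul)
  then show ?thesis using assms weights_combine[of l _ l' a b]
    by (auto simp: ext_cone_def lin_comb_combine algebra_simps)
qed

text \<open>An intermediate value argument: \<open>t - l i\<close> is linear on a convex cone, so it
  vanishes somewhere if it takes values of both signs.\<close>

lemma ext_cone_zero_crossing:
  assumes "subspace U" "(l, t) \<in> ext_cone U x ys" "(l', t') \<in> ext_cone U x ys"
    and "l i \<le> t" "t' \<le> l' i"
  shows "\<exists>(l, t)\<in>ext_cone U x ys. t = l i"
proof -
  consider "l i = t" | "l' i = t'" | "l i < t" "t' < l' i" using assms by linarith
  then show ?thesis
  proof cases
    case 3
    \<comment> \<open>Each pair is weighted by the size of the other pair's gap, so that the two
      gaps cancel.\<close>
    then have "((\<lambda>j. (l' i - t') * l j + (t - l i) * l' j), (l' i - t') * t + (t - l i) * t')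
        \<in> ext_cone U x ys"
      using assms by (intro ext_cone_combine) auto
    then show ?thesis by (rule bexI[rotated]) (auto simp: algebra_simps)
  qed (use assms in auto)
qed

section \<open>Intersection conditions read off the extended cone\<close>

lemma meets_span_insert:
  assumes "subspace U"
  shows "meets (span (insert x U)) ys \<longleftrightarrow> ext_cone U x ys \<noteq> {}"
proof -
  have "lin_comb l ys \<in> span (insert x U) \<longleftrightarrow> (\<exists>t. lin_comb l ys + t *\<^sub>R x \<in> U)" for l
  proof -
    have "(\<exists>k. lin_comb l ys - k *\<^sub>R x \<in> U) \<longleftrightarrow> (\<exists>t. lin_comb l ys + t *\<^sub>R x \<in> U)"
      by (auto intro: exI[of _ "- _"])
    then show ?thesis by (simp add: span_insert span_eq_iff[THEN iffD2, OF assms])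
  qed
  then show ?thesis by (auto simp: meets_def ext_cone_def)
qed

lemma meets_update:
  assumes "i < length ys"
  shows "meets U (ys[i := ys ! i + x]) \<longleftrightarrow> (\<exists>(l, t)\<in>ext_cone U x ys. t = l i)"
  using assms by (auto simp: meets_def ext_cone_def lin_comb_update)

lemma meets_iff_ext_cone: "meets U ys \<longleftrightarrow> (\<exists>(l, t)\<in>ext_cone U x ys. t = 0)"
  by (auto simp: meets_def ext_cone_def)

text \<open>Deleting the weight at \<open>p\<close> leaves a nonincreasing sequence; conversely
  \<open>t\<close> fits at \<open>p\<close> exactly when it lies between its two neighbours. The
  slot \<open>p = 0\<close> has no upper neighbour.\<close>

lemma meets_insert_at:
  assumes U: "subspace U" and x: "x \<notin> U" and p: "p \<le> length ys"
  shows "meets U (insert_at p x ys) \<longleftrightarrow>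
    (\<exists>(l, t)\<in>ext_cone U x ys. l p \<le> t \<and> (p = 0 \<or> t \<le> l (p - 1)))"
proof
  assume "meets U (insert_at p x ys)"
  then obtain l where l: "antimono l" "\<And>i. i \<ge> Suc (length ys) \<Longrightarrow> l i = 0" "l 0 > 0"
    and c: "lin_comb l (insert_at p x ys) \<in> U"
    by (auto simp: meets_def weights_def)
  define l' where "l' i = l (if i < p then i else Suc i)" for i
  have c': "lin_comb l' ys + l p *\<^sub>R x \<in> U" using c p by (simp add: lin_comb_insert_at l'_def[abs_def])
  have "antimono l'" by (rule antimonoI) (auto simp: l'_def intro!: antimonoD[OF l(1)])
  moreover have tail: "\<And>i. i \<ge> length ys \<Longrightarrow> l' i = 0" using l(2) p by (auto simp: l'_def)
  \<comment> \<open>If the remaining weights all vanished, only \<open>x\<close> would carry weight,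
    and a positive multiple of \<open>x\<close> would lie in \<open>U\<close>.\<close>
  moreover have "l' 0 > 0"
  proof (rule ccontr)
    assume "\<not> l' 0 > 0"
    moreover have "l' i \<ge> 0" for i
      using antimonoD[OF \<open>antimono l'\<close>, of i "max i (length ys)"] tail[of "max i (length ys)"] by simp
    moreover have "l' i \<le> l' 0" for i using antimonoD[OF \<open>antimono l'\<close>, of 0 i] by simp
    ultimately have zero: "l' i = 0" for i by (meson antisym not_le_imp_less order.trans)
    then have "lin_comb l' ys = 0" by (simp add: lin_comb_def)
    then have "l p *\<^sub>R x \<in> U" using c' by simp
    then have "l p = 0" using subspace_mul[OF U, of "l p *\<^sub>R x" "inverse (l p)"] x
      by (cases "l p = 0") auto
    moreover have "p = 0" using zero[of 0] l(3) by (auto simp: l'_def split: if_splits)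
    ultimately show False using l(3) by simp
  qed
  ultimately have "(l', l p) \<in> ext_cone U x ys" using c' by (simp add: ext_cone_def weights_def)
  moreover have "l' p \<le> l p" "p = 0 \<or> l p \<le> l' (p - 1)"
    by (auto simp: l'_def intro!: antimonoD[OF l(1)])
  ultimately show "\<exists>(l, t)\<in>ext_cone U x ys. l p \<le> t \<and> (p = 0 \<or> t \<le> l (p - 1))" by blast
next
  assume "\<exists>(l, t)\<in>ext_cone U x ys. l p \<le> t \<and> (p = 0 \<or> t \<le> l (p - 1))"
  then obtain l t where l: "antimono l" "\<And>i. i \<ge> length ys \<Longrightarrow> l i = 0" "l 0 > 0"
    and c: "lin_comb l ys + t *\<^sub>R x \<in> U" and t: "l p \<le> t" "p = 0 \<or> t \<le> l (p - 1)"
    by (auto simp: ext_cone_def weights_def)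
  define l' where "l' i = (if i < p then l i else if i = p then t else l (i - 1))" for i
  have "(\<lambda>i. l' (if i < p then i else Suc i)) = l" "l' p = t" by (auto simp: l'_def)
  then have "lin_comb l' (insert_at p x ys) \<in> U" using c p by (simp add: lin_comb_insert_at)
  moreover have "antimono l'"
    unfolding antimono_iff_le_Suc
  proof
    fix i
    consider "Suc i < p" | "Suc i = p" | "i = p" | "i > p" by linarith
    then show "l' (Suc i) \<le> l' i"
      using t by cases (auto simp: l'_def intro!: antimonoD[OF l(1)])
  qed
  moreover have "l' 0 > 0" using l(3) t by (auto simp: l'_def)
  moreover have "l' i = 0" if "i \<ge> Suc (length ys)" for i using that p l(2) by (auto simp: l'_def)
  ultimately show "meets U (insert_at p x ys)" by (auto simp: meets_def weights_def)
qed

text \<open>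
  The slots for the new coefficient \<open>t\<close> are the gaps between consecutive breakpoints \<open>l i\<close>, and merging
  \<open>x\<close> into \<open>ys ! i\<close> forces \<open>t = l i\<close>. By the intermediate value theorem on the cone, each slot and each
  breakpoint is attained iff \<open>t\<close> reaches both sides of it, so the difference of the two sums telescopes.
\<close>

lemma sum_meets_insert_at:
  fixes x :: "'v::real_vector"
  assumes U: "subspace U" and x: "x \<notin> U"
  shows "(\<Sum>p\<le>length ys. of_bool (meets U (insert_at p x ys))) =
    (\<Sum>i<length ys. of_bool (meets U (ys[i := ys ! i + x])))
    + (of_bool (\<exists>(l, t)\<in>ext_cone U x ys. t \<ge> 0) :: real)"
proof (cases "ext_cone U x ys = {}")
  case True
  then show ?thesis using assms by (simp add: meets_insert_at meets_update)
next
  case False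
  then obtain l0 t0 where lt: "(l0, t0) \<in> ext_cone U x ys" by auto
  define A where "A p \<longleftrightarrow> (\<exists>(l, t)\<in>ext_cone U x ys. l p \<le> t)" for p
  define C where "C p \<longleftrightarrow> (\<exists>(l, t)\<in>ext_cone U x ys. t \<le> l p)" for p
  \<comment> \<open>\<open>C' p\<close> is the upper condition of slot \<open>p\<close>, vacuous for
    the first slot.\<close>
  define C' where "C' p \<longleftrightarrow> p = 0 \<or> C (p - 1)" for p
  \<comment> \<open>At least one of the two conditions always holds, so the indicator of both is the
    sum of the indicators minus one. The same applies to \<open>slot\<close>.\<close>
  have wall: "of_bool (meets U (ys[i := ys ! i + x])) = (of_bool (A i) + of_bool (C i) - 1 :: real)"
    if "i < length ys" for i
  proof -
    have "A i \<or> C i" using lt linear[of t0 "l0 i"] unfolding A_def C_def by blast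
    moreover have "(\<exists>(l, t)\<in>ext_cone U x ys. t = l i) \<longleftrightarrow> A i \<and> C i"
    proof
      assume "A i \<and> C i"
      then obtain l t l' t' where "(l, t) \<in> ext_cone U x ys" "(l', t') \<in> ext_cone U x ys"
        "l i \<le> t" "t' \<le> l' i" unfolding A_def C_def by blast
      then show "\<exists>(l, t)\<in>ext_cone U x ys. t = l i" by (rule ext_cone_zero_crossing[OF U])
    qed (auto simp: A_def C_def)
    ultimately show ?thesis using that by (auto simp: meets_update)
  qed
  have slot: "of_bool (meets U (insert_at p x ys)) = (of_bool (A p) + of_bool (C' p) - 1 :: real)"
    if "p \<le> length ys" for p
  proof -
    have mono: "l p \<le> l (p - 1)" if "(l, t) \<in> ext_cone U x ys" for l t
      using that by (auto simp: ext_cone_def weights_def intro: antimonoD)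
    have "A p \<or> C' p"
    proof (cases "l0 p \<le> t0")
      case True
      then show ?thesis using lt unfolding A_def by blast
    next
      case False
      then have "t0 \<le> l0 (p - 1)" using mono[OF lt] by linarith
      then show ?thesis using lt unfolding C'_def C_def by blast
    qed
    moreover have "(\<exists>(l, t)\<in>ext_cone U x ys. l p \<le> t \<and> (p = 0 \<or> t \<le> l (p - 1))) \<longleftrightarrow> A p \<and> C' p"
    proof
      assume "A p \<and> C' p"
      then obtain l t where 1: "(l, t) \<in> ext_cone U x ys" "l p \<le> t" and "C' p"
        unfolding A_def by blast
      then consider "p = 0" | l' t' where "(l', t') \<in> ext_cone U x ys" "t' \<le> l' (p - 1)"
        unfolding C'_def C_def by blast
      then show "\<exists>(l, t)\<in>ext_cone U x ys. l p \<le> t \<and> (p = 0 \<or> t \<le> l (p - 1))"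
      proof cases
        case 2
        show ?thesis
        proof (cases "t' \<ge> l' p")
          \<comment> \<open>Here \<open>t'\<close> lies below the slot, and crossing from
            \<open>(l, t)\<close> to \<open>(l', t')\<close> gives a pair whose coefficient sits
            exactly at the lower end of the slot.\<close>
          case False
          then obtain l'' where "(l'', l'' p) \<in> ext_cone U x ys"
            using ext_cone_zero_crossing[OF U 1(1) 2(1), of p] 1(2) by force
          then show ?thesis using mono[of l'' "l'' p"] by (intro bexI[of _ "(l'', l'' p)"]) auto
        qed (use 2 in auto)
      qed (use 1 in auto)
    qed (auto simp: A_def C_def C'_def)
    ultimately show ?thesis using that by (auto simp: meets_insert_at[OF U x])
  qed
  \<comment> \<open>Since \<open>C' (Suc p)\<close> is \<open>C p\<close> and \<open>C' 0\<close> is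
    true, all terms cancel except \<open>A m\<close>.\<close>
  have "(\<Sum>p\<le>m. of_bool (A p) + of_bool (C' p) - 1 :: real) =
      (\<Sum>i<m. of_bool (A i) + of_bool (C i) - 1) + of_bool (A m)" for m
    by (induction m) (auto simp: C'_def)
  moreover have "A (length ys) \<longleftrightarrow> (\<exists>(l, t)\<in>ext_cone U x ys. t \<ge> 0)"
    unfolding A_def by (intro bex_cong) (auto simp: ext_cone_def weights_def)
  ultimately show ?thesis by (simp add: slot wall)
qed

lemma ext_cone_uminus: "(l, t) \<in> ext_cone U (- x) ys \<longleftrightarrow> (l, - t) \<in> ext_cone U x ys"
  by (simp add: ext_cone_def)

text \<open>Adding the identities for \<open>x\<close> and \<open>- x\<close> leaves the indicators
  of \<open>P\<close> and \<open>N\<close>. Both hold iff \<open>t = 0\<close> is attained, one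
  holds iff the cone is nonempty, and [P] + [N] = [P or N] + [P and N].\<close>

lemma insert_sum_meets:
  fixes x :: "'v::real_vector"
  assumes U: "subspace U" and x: "x \<notin> U"
  shows "insert_sum x (\<lambda>ys. of_bool (meets U ys)) ys =
    merge_sum x (\<lambda>ys. of_bool (meets U ys)) ys
    + of_bool (meets (span (insert x U)) ys) + of_bool (meets U ys)"
proof -
  have x': "- x \<notin> U" using U x by (metis minus_minus subspace_neg)
  define P N where "P \<longleftrightarrow> (\<exists>(l, t)\<in>ext_cone U x ys. t \<ge> 0)"
    and "N \<longleftrightarrow> (\<exists>(l, t)\<in>ext_cone U x ys. t \<le> 0)"
  have neg: "(\<exists>(l, t)\<in>ext_cone U (- x) ys. t \<ge> 0) \<longleftrightarrow> N"
    unfolding N_def by (auto simp: ext_cone_uminus intro!: bexI[of _ "(_, - _)"])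
  have zero: "meets U ys \<longleftrightarrow> P \<and> N"
  proof
    assume "P \<and> N"
    then obtain l t l' t' where 
      "(l, t) \<in> ext_cone U x ys" "(l', t') \<in> ext_cone U x ys" "t \<ge> 0" "t' \<le> 0"
      by (auto simp: P_def N_def)
    \<comment> \<open>The index \<open>length ys\<close> is chosen because the weight there is zero,
      so the crossing occurs at \<open>t = 0\<close>.\<close>
    then have "\<exists>(l, t)\<in>ext_cone U x ys. t = l (length ys)"
      using ext_cone_zero_crossing[OF U, of l t x ys l' t' "length ys"]
      by (auto simp: ext_cone_def weights_def)
    then show "meets U ys"
      by (subst meets_iff_ext_cone[of _ _ x]) (auto simp: ext_cone_def weights_def)
  qed (force simp: P_def N_def meets_iff_ext_cone[of _ _ x])
  have nonempty: "meets (span (insert x U)) ys \<longleftrightarrow> P \<or> N"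
    unfolding meets_span_insert[OF U] P_def N_def by force
  have "insert_sum x (\<lambda>ys. of_bool (meets U ys)) ys =
    merge_sum x (\<lambda>ys. of_bool (meets U ys)) ys + of_bool P + of_bool N"
    unfolding insert_sum_def merge_sum_def sum.distrib
    using sum_meets_insert_at[OF U x, of ys] sum_meets_insert_at[OF U x', of ys]
    by (simp add: neg P_def)
  also have "\<dots> = merge_sum x (\<lambda>ys. of_bool (meets U ys)) ys
    + of_bool (meets (span (insert x U)) ys) + of_bool (meets U ys)"
    by (auto simp: zero nonempty)
  finally show ?thesis .
qed

text \<open>Complementing preserves the identity because both sides consist of
  \<open>2 * length ys + 2\<close> indicators.\<close>

lemma insert_sum_not_meets:
  fixes x :: "'v::real_vector"
  assumes U: "subspace U" and x: "x \<notin> U"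
  shows "insert_sum x (\<lambda>ys. of_bool (\<not> meets U ys)) ys =
    merge_sum x (\<lambda>ys. of_bool (\<not> meets U ys)) ys
    + of_bool (\<not> meets (span (insert x U)) ys) + of_bool (\<not> meets U ys)"
  using insert_sum_meets[OF assms, of ys]
  by (simp add: insert_sum_def merge_sum_def of_bool_not_iff sum.distrib sum_subtractf algebra_simps)

section \<open>Counting for generic vectors\<close>

text \<open>Here \<open>c\<close> is the codimension of the subspace. The factor
  \<open>2 * n + 1\<close> collects the \<open>2 * n\<close> merged lists and the unchanged one. The
  empty list avoids every subspace, even for \<open>c = 0\<close>.\<close>

fun num_avoid :: "nat \<Rightarrow> nat \<Rightarrow> real" where
  "num_avoid 0 c = 1"
| "num_avoid (Suc n) 0 = 0"
| "num_avoid (Suc n) (Suc c) = num_avoid n c + (2 * n + 1) * num_avoid n (Suc c)"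

text \<open>
  Genericity is defined along the recursion, with the subspace kept as an orthogonal spanning list so that
  non-membership in it becomes the visibly measurable condition \<open>resid us x \<noteq> 0\<close>.
\<close>

definition resid :: "'v::euclidean_space list \<Rightarrow> 'v \<Rightarrow> 'v" where
  "resid us x = x - (\<Sum>u\<leftarrow>us. ((x \<bullet> u) / (u \<bullet> u)) *\<^sub>R u)"

function generic :: "'v::euclidean_space list \<Rightarrow> 'v list \<Rightarrow> bool" where
  "generic us [] \<longleftrightarrow> True"
| "generic us (x # xs) \<longleftrightarrow> length us < DIM('v) \<longrightarrow>
     resid us x \<noteq> 0 \<and> generic us xs \<and> generic (resid us x # us) xs \<and>
     (\<forall>i<length xs. generic us (xs[i := xs ! i + x]) \<and> generic us (xs[i := xs ! i - x]))"
  by pat_completeness auto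
termination by (relation "Wellfounded.measure (\<lambda>(us, xs). length xs)") auto

declare generic.simps(2) [simp del]

section \<open>Orthogonal lists and Gram-Schmidt residuals\<close>

definition orth_list :: "'v::euclidean_space list \<Rightarrow> bool" where
  "orth_list us \<longleftrightarrow> distinct us \<and> 0 \<notin> set us \<and> pairwise orthogonal (set us)"

lemma resid_diff_in_span: "x - resid us x \<in> span (set us)"
proof -
  have "(\<Sum>u\<leftarrow>vs. c u *\<^sub>R u) \<in> span (set us)" if "set vs \<subseteq> set us" for c :: "'a \<Rightarrow> real" and vs
    using that by (induction vs) (auto intro: span_add span_mul span_base span_zero)
  then show ?thesis by (simp add: resid_def)
qed

lemma resid_orthogonal:
  assumes "orth_list us" "v \<in> set us"
  shows "resid us x \<bullet> v = 0"
proof -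
  have "v \<noteq> 0" and orth: "\<And>u. u \<in> set us - {v} \<Longrightarrow> u \<bullet> v = 0"
    using assms by (auto simp: orth_list_def pairwise_def orthogonal_def)
  then have "(\<Sum>u\<in>set us. ((x \<bullet> u) / (u \<bullet> u)) *\<^sub>R u) \<bullet> v = x \<bullet> v"
    using assms(2) by (simp add: inner_add_left inner_sum_left sum.remove[of _ v])
  then show ?thesis using assms
    by (simp add: resid_def inner_diff_left orth_list_def sum_list_distinct_conv_sum_set)
qed

text \<open>For a vector of the span, the residual lies in the span and is orthogonal to it, hence
  is zero.\<close>

lemma resid_nonzero_imp_notin_span:
  assumes "orth_list us" "resid us x \<noteq> 0"
  shows "x \<notin> span (set us)"
proof
  assume "x \<in> span (set us)"
  then have "resid us x \<in> span (set us)"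
    using span_diff[OF _ resid_diff_in_span[of x us], of x] by simp
  moreover have "\<And>y. y \<in> span (set us) \<Longrightarrow> orthogonal (resid us x) y"
    by (rule orthogonal_to_span) (auto simp: orthogonal_def resid_orthogonal[OF assms(1)])
  ultimately have "orthogonal (resid us x) (resid us x)" by blast
  then show False using assms(2) by (simp add: orthogonal_self)
qed

lemma orth_list_Cons_resid:
  assumes "orth_list us" "resid us x \<noteq> 0"
  shows "orth_list (resid us x # us)"
proof -
  have "resid us x \<notin> set us" using assms resid_orthogonal[of us "resid us x" x] by auto
  then show ?thesis using assms resid_orthogonal[OF assms(1), of _ x]
    by (auto simp: orth_list_def pairwise_insert orthogonal_def inner_commute)
qed

lemma span_orth_list_UNIV:
  fixes us :: "'v::euclidean_space list"
  assumes "orth_list us" "length us = DIM('v)"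
  shows "span (set us) = UNIV"
proof -
  have "independent (set us)" using assms pairwise_orthogonal_independent[of "set us"] by (simp add: orth_list_def)
  moreover have "card (set us) = DIM('v)" using assms by (simp add: orth_list_def distinct_card)
  ultimately show ?thesis using card_eq_dim[of "set us" UNIV] by auto
qed

text \<open>A Gram-Schmidt step: enlarging the subspace by \<open>x\<close> amounts to prepending
  the residual of \<open>x\<close> to the orthogonal list.\<close>

lemma span_insert_resid: "span (insert x (span (set us))) = span (set (resid us x # us))"
proof -
  have "span (insert x (span (set us))) = span (insert x (set us))" by (simp only: span_insert span_span)
  also have "\<dots> = span (insert (resid us x) (set us))" by (rule eq_span_insert_eq) (rule resid_diff_in_span)
  finally show ?thesis by simp
qed

lemma meets_Nil [simp]: "\<not> meets U []"
  by (auto simp: meets_def weights_def)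

lemma meets_UNIV: "ys \<noteq> [] \<Longrightarrow> meets UNIV ys"
  unfolding meets_def
  by (rule bexI[of _ "\<lambda>i. if i < length ys then 1 else 0"]) (auto simp: weights_def antimono_def)

text \<open>Induction on the length of \<open>xs\<close>, for all \<open>us\<close> at once: the
  recursion leads to lists with a merged entry, which are not tails of \<open>xs\<close>, and to
  subspaces enlarged by \<open>x\<close>.\<close>

lemma signed_perm_sum_not_meets:
  fixes us xs :: "'v::euclidean_space list"
  assumes "orth_list us" "length us \<le> DIM('v)" "generic us xs"
  shows "signed_perm_sum (\<lambda>ys. of_bool (\<not> meets (span (set us)) ys)) xs =
    num_avoid (length xs) (DIM('v) - length us)"
  using assms
proof (induction "length xs" arbitrary: us xs)
  case 0
  then show ?case by simp
next
  case (Suc n)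
  define F where "F us ys = (of_bool (\<not> meets (span (set us)) ys) :: real)" for us ys :: "'v list"
  obtain x xs' where xs: "xs = x # xs'" and n: "length xs' = n"
    using Suc.hyps(2) by (cases xs) auto
  show ?case
  proof (cases "length us = DIM('v)")
    case True
    then have "signed_perm_sum (F us) xs = signed_perm_sum (\<lambda>_. 0) xs"
      using Suc.prems Suc.hyps(2)
      by (intro signed_perm_sum_cong) (auto simp: F_def span_orth_list_UNIV intro!: meets_UNIV)
    also have "\<dots> = 0" using signed_perm_sum_const[of 0] by simp
    finally show ?thesis using True by (simp add: F_def[abs_def] flip: Suc.hyps(2))
  next
    case False
    then have lt: "length us < DIM('v)" using Suc.prems by simp
    define r where "r = resid us x"
    define c where "c = DIM('v) - Suc (length us)"
    have g: "r \<noteq> 0" "generic us xs'" "generic (r # us) xs'"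
      "\<And>i. i < n \<Longrightarrow> generic us (xs'[i := xs' ! i + x])"
      "\<And>i. i < n \<Longrightarrow> generic us (xs'[i := xs' ! i - x])"
      using Suc.prems lt n by (auto simp: xs r_def generic.simps(2))
    have IH: "signed_perm_sum (F us) zs = num_avoid n (Suc c)" if "length zs = n" "generic us zs" for zs
      using Suc.hyps(1)[of zs us] Suc.prems that lt
      by (simp add: F_def[abs_def] c_def Suc_diff_Suc)
    have IH': "signed_perm_sum (F (r # us)) xs' = num_avoid n c"
      using Suc.hyps(1)[of xs' "r # us"] Suc.prems n lt g orth_list_Cons_resid[of us x]
      by (simp add: F_def[abs_def] c_def r_def)
    have "x \<notin> span (set us)"
      using resid_nonzero_imp_notin_span Suc.prems g(1) by (auto simp: r_def)
    then have "insert_sum x (F us) = (\<lambda>ys. (merge_sum x (F us) ys + F (r # us) ys) + F us ys)"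
      unfolding F_def r_def
      by (intro ext) (subst insert_sum_not_meets[OF subspace_span], assumption, simp only: span_insert_resid)
    then have "signed_perm_sum (F us) xs =
        merge_sum x (signed_perm_sum (F us)) xs' + signed_perm_sum (F (r # us)) xs' + signed_perm_sum (F us) xs'"
      by (simp add: xs signed_perm_sum_add signed_perm_sum_merge_sum)
    \<comment> \<open>All \<open>2 * n\<close> merged lists are generic of length \<open>n\<close>,
      so each contributes the same count.\<close>
    also have "merge_sum x (signed_perm_sum (F us)) xs' = (\<Sum>i<n. 2 * num_avoid n (Suc c))"
      unfolding merge_sum_def n by (intro sum.cong) (auto simp: IH g n)
    also have "(\<Sum>i<n. 2 * num_avoid n (Suc c)) + signed_perm_sum (F (r # us)) xs' + signed_perm_sum (F us) xs'
        = num_avoid (Suc n) (Suc c)"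
      by (simp add: IH g n IH' algebra_simps)
    finally show ?thesis using lt by (simp add: F_def[abs_def] c_def Suc_diff_Suc flip: Suc.hyps(2))
  qed
qed

section \<open>Measurability and almost sure genericity\<close>

lemma sets_generic:
  fixes us xs :: "('w \<Rightarrow> 'v::euclidean_space) list"
  assumes "set us \<subseteq> borel_measurable N" "set xs \<subseteq> borel_measurable N"
  shows "{w \<in> space N. generic (map (\<lambda>u. u w) us) (map (\<lambda>x. x w) xs)} \<in> sets N"
  using assms
proof (induction "length xs" arbitrary: us xs)
  case 0
  then show ?case by simp
next
  case (Suc n)
  obtain x xs' where xs: "xs = x # xs'" and n: "length xs' = n"
    using Suc.hyps(2) by (cases xs) auto
  have [measurable]: "x \<in> borel_measurable N" using Suc.prems by (auto simp: xs)
  define r where "r w = resid (map (\<lambda>u. u w) us) (x w)" for w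
  have r [measurable]: "r \<in> borel_measurable N"
  proof -
    have "(\<lambda>w. \<Sum>u\<leftarrow>vs. ((x w \<bullet> u w) / (u w \<bullet> u w)) *\<^sub>R u w) \<in> borel_measurable N"
      if "set vs \<subseteq> borel_measurable N" for vs
      using that
    proof (induction vs)
      case (Cons v vs)
      then have [measurable]: "v \<in> borel_measurable N" by simp
      show ?case using Cons by simp
    qed simp
    then show ?thesis using Suc.prems unfolding r_def resid_def by (simp add: comp_def)
  qed
  \<comment> \<open>The lists hold functions of \<open>w\<close> because the residual and the merged
    entries met in the recursion depend on \<open>w\<close>.\<close>
  define P where "P vs zs w \<longleftrightarrow> generic (map (\<lambda>u. u w) vs) (map (\<lambda>x. x w) zs)"
    for vs zs :: "('w \<Rightarrow> 'v) list" and w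
  have P: "Measurable.pred N (P vs zs)" 
    if "set vs \<subseteq> borel_measurable N" "set zs \<subseteq> borel_measurable N" "length zs = n" for vs zs
    using Suc.hyps(1)[of zs vs] that by (simp add: pred_def P_def[abs_def])
  have upd: "set (xs'[i := (\<lambda>w. (xs' ! i) w + f w)]) \<subseteq> borel_measurable N"
    if "i < n" "f \<in> borel_measurable N" for i f
  proof -
    have "xs' ! i \<in> borel_measurable N" using Suc.prems that n nth_mem[of i xs'] by (auto simp: xs)
    then have "(\<lambda>w. (xs' ! i) w + f w) \<in> borel_measurable N" using that by measurable
    then show ?thesis
      using Suc.prems set_update_subset_insert[of xs' i "\<lambda>w. (xs' ! i) w + f w"] by (auto simp: xs)
  qed
  have eq: "P us xs w \<longleftrightarrow> (length us < DIM('v) \<longrightarrow>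
     r w \<noteq> 0 \<and> P us xs' w \<and> P (r # us) xs' w \<and>
     (\<forall>i\<in>{..<n}. P us (xs'[i := (\<lambda>w. (xs' ! i) w + x w)]) w
        \<and> P us (xs'[i := (\<lambda>w. (xs' ! i) w + - x w)]) w))" for w
    by (simp add: P_def xs r_def map_update n generic.simps(2) cong: conj_cong) (auto simp: n)
  have [measurable]: "Measurable.pred N (P us xs')" "Measurable.pred N (P (r # us) xs')"
    using Suc.prems n r by (auto intro!: P simp: xs)
  have [measurable]: "Measurable.pred N (P us (xs'[i := (\<lambda>w. (xs' ! i) w + x w)]))"
    "Measurable.pred N (P us (xs'[i := (\<lambda>w. (xs' ! i) w + - x w)]))" if "i \<in> {..<n}" for i
    using Suc.prems n that by (intro P upd; simp)+
  have "Measurable.pred N (P us xs)" unfolding eq by measurable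
  then show ?case by (simp add: pred_def P_def)
qed

text \<open>By Fubini, the first vector is fixed outside a null set and the rest follows by
  induction. The shift \<open>g\<close> keeps the claim stable: adding a fixed vector to an entry
  only changes \<open>g\<close>.\<close>

lemma AE_generic:
  fixes \<mu> :: "'v::euclidean_space measure" and g :: "nat \<Rightarrow> 'v"
  assumes "prob_space \<mu>" and sets[simp, measurable_cong]: "sets \<mu> = sets borel"
    and null: "\<And>a b. a \<noteq> 0 \<Longrightarrow> AE y in \<mu>. a \<bullet> y \<noteq> b"
    and "distinct js"
  shows "AE x in PiM (set js) (\<lambda>_. \<mu>). generic us (map (\<lambda>j. x j + g j) js)"
  using assms(4)
proof (induction js arbitrary: us g)
  case Nil
  then show ?case by simp
next
  case (Cons j js)
  interpret prob_space \<mu> by fact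
  interpret P: product_prob_space "\<lambda>_. \<mu>" "set js" by unfold_locales
  interpret PP: pair_prob_space \<mu> "PiM (set js) (\<lambda>_. \<mu>)" by unfold_locales
  show ?case
  proof (cases "length us < DIM('v)")
    case False
    then show ?thesis by (simp add: generic.simps(2))
  next
    case True
    have sp: "space \<mu> = UNIV" using sets_eq_imp_space_eq[OF sets] by simp
    define h where "h i x = x i + g i" for i :: nat and x :: "nat \<Rightarrow> 'v"
    let ?Q = "PiM (insert j (set js)) (\<lambda>_. \<mu>)"
    have meas: "{x \<in> space ?Q. generic us (map (\<lambda>j. x j + g j) (j # js))} \<in> sets ?Q"
    proof -
      have "h i \<in> borel_measurable ?Q" if "i \<in> insert j (set js)" for i
      proof -
        have "(\<lambda>x. x i) \<in> measurable ?Q \<mu>" using that by (rule measurable_component_singleton)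
        then have [measurable]: "(\<lambda>x. x i) \<in> borel_measurable ?Q"
          by (simp add: measurable_cong_sets[OF refl sets])
        show ?thesis unfolding h_def by measurable
      qed
      then have "{x \<in> space ?Q. generic (map (\<lambda>u. u x) (map (\<lambda>u _. u) us)) (map (\<lambda>f. f x) (map h (j # js)))} \<in> sets ?Q"
        by (intro sets_generic) auto
      then show ?thesis by (simp add: comp_def h_def)
    qed
    \<comment> \<open>Fewer than \<open>DIM('v)\<close> vectors span a proper subspace, which lies
      in the hyperplane normal to \<open>a\<close>.\<close>
    obtain a where a: "a \<noteq> 0" "\<And>y. y \<in> span (set us) \<Longrightarrow> orthogonal a y"
    proof -
      have "dim (set us) < DIM('v)"
        using dim_le_card'[OF finite_set, of us] card_length[of us] True by linarith
      then show ?thesis using that by (rule orthogonal_to_subspace_exists)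
    qed
    have ae: "AE y in \<mu>. AE x in PiM (set js) (\<lambda>_. \<mu>). generic us ((y + g j) # map (\<lambda>j. x j + g j) js)"
      \<comment> \<open>The first vector is \<open>y + g j\<close>, so \<open>y\<close> itself has
        to avoid a translate of the hyperplane.\<close>
      using null[of a "- (a \<bullet> g j)", OF a(1)]
    proof eventually_elim
      case (elim y)
      define z where "z = y + g j"
      have nz: "resid us z \<noteq> 0"
      proof
        assume "resid us z = 0"
        then have "z \<in> span (set us)" using resid_diff_in_span[of z us] by simp
        then have "a \<bullet> z = 0" using a(2) by (simp add: orthogonal_def)
        then show False using elim by (simp add: inner_add_right z_def)
      qed
      have shift: "(map (\<lambda>j. x j + g j) js)[i := map (\<lambda>j. x j + g j) js ! i + z] =
         map (\<lambda>k. x k + (g(js ! i := g (js ! i) + z)) k) js" if "i < length js" for i x z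
        using Cons.prems that
        by (intro nth_equalityI) (auto simp: nth_list_update nth_eq_iff_index_eq add.assoc)
      have upd: "AE x in PiM (set js) (\<lambda>_. \<mu>). \<forall>i\<in>{..<length js}.
          generic us ((map (\<lambda>j. x j + g j) js)[i := map (\<lambda>j. x j + g j) js ! i + z])" for z
      proof (rule AE_finite_allI)
        fix i assume "i \<in> {..<length js}"
        then show "AE x in PiM (set js) (\<lambda>_. \<mu>). 
          generic us ((map (\<lambda>j. x j + g j) js)[i := map (\<lambda>j. x j + g j) js ! i + z])"
          using Cons.IH[of us "g(js ! i := g (js ! i) + z)"] Cons.prems by (simp only: shift lessThan_iff) simp
      qed simp
      have "AE x in PiM (set js) (\<lambda>_. \<mu>). generic us (map (\<lambda>j. x j + g j) js)"
        "AE x in PiM (set js) (\<lambda>_. \<mu>). generic (resid us z # us) (map (\<lambda>j. x j + g j) js)"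
        using Cons by auto
      with upd[of z] upd[of "- z"] show ?case
        unfolding z_def[symmetric]
        by eventually_elim (auto simp: generic.simps(2) nz)
    qed
    \<comment> \<open>Splitting off coordinate \<open>j\<close> writes the product measure as the
      image of a pair measure, where the fibrewise statement \<open>ae\<close> applies.\<close>
    have upd_meas: "(\<lambda>(y, x). x(j := y)) \<in> measurable (\<mu> \<Otimes>\<^sub>M PiM (set js) (\<lambda>_. \<mu>)) ?Q"
      by measurable
    have "AE p in \<mu> \<Otimes>\<^sub>M PiM (set js) (\<lambda>_. \<mu>). 
        generic us (map (\<lambda>i. (case p of (y, x) \<Rightarrow> x(j := y)) i + g i) (j # js))"
    proof (rule PP.AE_pair_measure)
      from measurable_sets[OF upd_meas meas]
      show "{p \<in> space (\<mu> \<Otimes>\<^sub>M PiM (set js) (\<lambda>_. \<mu>)). 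
        generic us (map (\<lambda>i. (case p of (y, x) \<Rightarrow> x(j := y)) i + g i) (j # js))}
        \<in> sets (\<mu> \<Otimes>\<^sub>M PiM (set js) (\<lambda>_. \<mu>))"
        by (rule back_subst[of "\<lambda>S. S \<in> _"])
          (auto simp: vimage_def space_pair_measure space_PiM PiE_def extensional_def sp split: prod.splits)
      have *: "map (\<lambda>i. (case (y, x) of (y, x) \<Rightarrow> x(j := y)) i + g i) (j # js) =
          (y + g j) # map (\<lambda>j. x j + g j) js" for y x
        using Cons.prems by auto
      show "AE y in \<mu>. AE x in PiM (set js) (\<lambda>_. \<mu>). 
        generic us (map (\<lambda>i. (case (y, x) of (y, x) \<Rightarrow> x(j := y)) i + g i) (j # js))"
        using ae by (simp only: *)
    qed
    then have "AE x in distr (\<mu> \<Otimes>\<^sub>M PiM (set js) (\<lambda>_. \<mu>)) ?Q (\<lambda>(y, x). x(j := y)).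
        generic us (map (\<lambda>i. x i + g i) (j # js))"
      unfolding AE_distr_iff[OF upd_meas meas] .
    also have "distr (\<mu> \<Otimes>\<^sub>M PiM (set js) (\<lambda>_. \<mu>)) ?Q (\<lambda>(y, x). x(j := y)) = ?Q"
      by (rule distr_pair_PiM_eq_PiM) unfold_locales
    finally show ?thesis unfolding list.set .
  qed
qed

section \<open>Convex hulls of prefix sums\<close>

text \<open>The weights are indexed by \<open>k\<close> and not by points, as \<open>f\<close> may
  repeat values.\<close>

lemma convex_hull_image_subset_sums:
  fixes f :: "nat \<Rightarrow> 'v::real_vector"
  shows "convex hull (f ` {..<n}) \<subseteq>
    {\<Sum>k<n. w k *\<^sub>R f k |w. (\<forall>k<n. 0 \<le> w k) \<and> sum w {..<n} = 1}" (is "_ \<subseteq> ?C")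
proof (rule hull_minimal)
  show "f ` {..<n} \<subseteq> ?C"
  proof
    fix y assume "y \<in> f ` {..<n}"
    then obtain i where "i < n" "y = f i" by auto
    then show "y \<in> ?C"
      by (intro CollectI exI[of _ "\<lambda>k. if k = i then 1 else 0"])
        (auto simp: if_distrib[of "\<lambda>c. c *\<^sub>R _"] cong: if_cong)
  qed
  show "convex ?C"
    unfolding convex_def
  proof (intro ballI allI impI)
    fix x y and u v :: real assume "x \<in> ?C" "y \<in> ?C" and uv: "0 \<le> u" "0 \<le> v" "u + v = 1"
    then obtain a b where "\<forall>k<n. 0 \<le> a k" "sum a {..<n} = 1" "x = (\<Sum>k<n. a k *\<^sub>R f k)"
      "\<forall>k<n. 0 \<le> b k" "sum b {..<n} = 1" "y = (\<Sum>k<n. b k *\<^sub>R f k)" by blast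
    with uv show "u *\<^sub>R x + v *\<^sub>R y \<in> ?C"
      by (intro CollectI exI[of _ "\<lambda>k. u * a k + v * b k"])
        (auto simp: scaleR_sum_right scaleR_add_left sum.distrib simp flip: sum_distrib_left)
  qed
qed

text \<open>Summation by parts in both directions: the differences \<open>l k - l (Suc k)\<close>
  are the coefficients of the prefix sums, and tail sums of such coefficients give back
  \<open>l\<close>.\<close>

lemma zero_in_convex_hull_prefix_sums:
  fixes X :: "nat \<Rightarrow> 'v::real_vector"
  shows "0 \<in> convex hull ((\<lambda>k. \<Sum>i\<in>{1..k}. X i) ` {1..n}) \<longleftrightarrow> meets {0} (map X [1..<Suc n])"
proof -
  define S where "S k = (\<Sum>i\<in>{1..k}. X i)" for k
  define Y where "Y i = X (Suc i)" for i
  have S: "S (Suc k) = (\<Sum>i\<le>k. Y i)" for k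
    unfolding S_def Y_def by (simp add: sum.atLeast1_atMost_eq flip: lessThan_Suc_atMost)
  have lin_comb: "lin_comb l (map X [1..<Suc n]) = (\<Sum>i<n. l i *\<^sub>R Y i)" for l
    by (auto simp: lin_comb_def Y_def intro!: sum.cong simp del: upt_Suc)
  have abel: "(\<Sum>i<n. l i *\<^sub>R Y i) = (\<Sum>k<n. (l k - l (Suc k)) *\<^sub>R S (Suc k))" if "l n = 0" for l
  proof -
    have "(\<Sum>i<m. l i *\<^sub>R Y i) = (\<Sum>k<m. (l k - l (Suc k)) *\<^sub>R S (Suc k)) + l m *\<^sub>R (\<Sum>i<m. Y i)" for m
      by (induction m) (auto simp: S lessThan_Suc_atMost[symmetric] algebra_simps)
    then show ?thesis using that by simp
  qed
  have img: "(\<lambda>k. \<Sum>i\<in>{1..k}. X i) ` {1..n} = (\<lambda>k. S (Suc k)) ` {..<n}"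
    by (simp only: S_def image_Suc_lessThan[of n, symmetric] image_image)
  \<comment> \<open>Dividing by the total weight shows that, for the point 0, a positive total is as
    good as total one.\<close>
  have "0 \<in> convex hull ((\<lambda>k. S (Suc k)) ` {..<n}) \<longleftrightarrow>
      (\<exists>w. (\<forall>k<n. 0 \<le> w k) \<and> (\<exists>k<n. w k > 0) \<and> (\<Sum>k<n. w k *\<^sub>R S (Suc k)) = 0)" (is "_ \<longleftrightarrow> ?R")
  proof
    assume "0 \<in> convex hull ((\<lambda>k. S (Suc k)) ` {..<n})"
    then obtain w where w: "\<And>k. k < n \<Longrightarrow> 0 \<le> w k" "sum w {..<n} = 1"
        "(\<Sum>k<n. w k *\<^sub>R S (Suc k)) = 0"
      using convex_hull_image_subset_sums[of "\<lambda>k. S (Suc k)" n] by force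
    moreover have "\<exists>k<n. w k > 0"
      using w(2) sum_nonpos[of "{..<n}" w] by (force simp: not_less)
    ultimately show ?R by auto
  next
    assume ?R
    then obtain w k where w: "\<And>k. k < n \<Longrightarrow> 0 \<le> w k" "k < n" "w k > 0" "(\<Sum>k<n. w k *\<^sub>R S (Suc k)) = 0"
      by auto
    define W where "W = sum w {..<n}"
    have "W > 0" unfolding W_def using w by (intro sum_pos2[of _ k]) auto
    have "(\<Sum>k<n. (w k / W) *\<^sub>R S (Suc k)) \<in> convex hull ((\<lambda>k. S (Suc k)) ` {..<n})"
      using w \<open>W > 0\<close>
      by (intro convex_sum) (auto simp: W_def hull_inc simp flip: sum_divide_distrib)
    also have "(\<Sum>k<n. (w k / W) *\<^sub>R S (Suc k)) = (1 / W) *\<^sub>R (\<Sum>k<n. w k *\<^sub>R S (Suc k))"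
      by (simp add: scaleR_sum_right)
    finally show "0 \<in> convex hull ((\<lambda>k. S (Suc k)) ` {..<n})" using w(4) by simp
  qed
  also have "?R \<longleftrightarrow> meets {0} (map X [1..<Suc n])"
  proof
    assume ?R
    then obtain w j where w: "\<And>k. k < n \<Longrightarrow> 0 \<le> w k" "j < n" "w j > 0" "(\<Sum>k<n. w k *\<^sub>R S (Suc k)) = 0"
      by auto
    define l where "l i = sum w {i..<n}" for i
    have diff: "l k - l (Suc k) = w k" if "k < n" for k
      using that by (simp add: l_def sum.atLeast_Suc_lessThan)
    have "antimono l" unfolding antimono_iff_le_Suc
    proof
      fix k show "l (Suc k) \<le> l k" using diff[of k] w(1)[of k] by (cases "k < n") (auto simp: l_def)
    qed
    moreover have "l 0 > 0" unfolding l_def using w by (intro sum_pos2[of _ j]) auto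
    moreover have "(\<Sum>i<n. l i *\<^sub>R Y i) = 0"
      by (subst abel) (auto simp: l_def diff[unfolded l_def] w(4))
    ultimately show "meets {0} (map X [1..<Suc n])"
      unfolding meets_def weights_def lin_comb
      by (intro bexI[of _ l]) (auto simp: l_def simp del: upt_Suc)
  next
    assume "meets {0} (map X [1..<Suc n])"
    then obtain l where l: "antimono l" "\<And>i. i \<ge> n \<Longrightarrow> l i = 0" "l 0 > 0" "(\<Sum>i<n. l i *\<^sub>R Y i) = 0"
      unfolding meets_def weights_def lin_comb by (auto simp del: upt_Suc)
    \<comment> \<open>Without a strict drop, \<open>l 0\<close> would be at most \<open>l n\<close>,
      which is zero.\<close>
    have "\<exists>k<n. l k - l (Suc k) > 0"
    proof (rule ccontr)
      assume "\<not> ?thesis"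
      then have step: "l k \<le> l (Suc k)" if "k < n" for k using that
        by (meson diff_gt_0_iff_gt not_le_imp_less)
      have "l 0 \<le> l k" if "k \<le> n" for k
        using that by (induction k) (auto intro!: order.trans[OF _ step])
      from this[of n] show False using l(2)[of n] l(3) by simp
    qed
    moreover have "l (Suc k) \<le> l k" for k using antimonoD[OF l(1), of k "Suc k"] by simp
    ultimately show ?R using abel[of l] l(2,4)
      by (intro exI[of _ "\<lambda>k. l k - l (Suc k)"]) auto
  qed
  finally show ?thesis unfolding img .
qed

text \<open>By separation, 0 lies outside the compact hull iff some \<open>a\<close> has positive
  inner product with all the points. Such \<open>a\<close> form an open set, so a countable dense
  set of them suffices.\<close>

lemma sets_zero_notin_convex_hull:
  fixes X :: "nat \<Rightarrow> 'w \<Rightarrow> 'v::euclidean_space"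
  assumes X: "\<And>i. i \<in> I \<Longrightarrow> X i \<in> borel_measurable N" and I: "finite I"
  shows "{w \<in> space N. 0 \<notin> convex hull ((\<lambda>i. X i w) ` I)} \<in> sets N"
proof -
  obtain D :: "'v set" where D: "countable D" "\<And>A. open A \<Longrightarrow> A \<noteq> {} \<Longrightarrow> \<exists>d\<in>D. d \<in> A"
    using countable_dense_setE by blast
  have eq: "0 \<notin> convex hull ((\<lambda>i. X i w) ` I) \<longleftrightarrow> (\<exists>a\<in>D. \<forall>i\<in>I. a \<bullet> X i w > 0)" for w
  proof
    assume "0 \<notin> convex hull ((\<lambda>i. X i w) ` I)"
    then obtain a b where "b > 0" "\<forall>x\<in>convex hull ((\<lambda>i. X i w) ` I). a \<bullet> x > b"
      using separating_hyperplane_closed_0[of "convex hull ((\<lambda>i. X i w) ` I)"] I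
      by (auto simp: finite_imp_compact_convex_hull compact_imp_closed)
    then have "a \<in> (\<Inter>i\<in>I. {a. a \<bullet> X i w > 0})"
      by (auto intro: hull_inc less_trans)
    moreover have "open (\<Inter>i\<in>I. {a. a \<bullet> X i w > 0})"
      using I by (intro open_INT) (auto intro!: open_Collect_less continuous_intros)
    ultimately show "\<exists>a\<in>D. \<forall>i\<in>I. a \<bullet> X i w > 0" using D(2) by fastforce
  next
    assume "\<exists>a\<in>D. \<forall>i\<in>I. a \<bullet> X i w > 0"
    then obtain a where a: "\<And>i. i \<in> I \<Longrightarrow> a \<bullet> X i w > 0" by blast
    have "convex hull ((\<lambda>i. X i w) ` I) \<subseteq> {x. a \<bullet> x > 0}"
      using a by (intro hull_minimal) (auto simp: convex_halfspace_gt)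
    then show "0 \<notin> convex hull ((\<lambda>i. X i w) ` I)" by auto
  qed
  have [measurable]: "\<And>i. i \<in> I \<Longrightarrow> X i \<in> borel_measurable N" by (rule X)
  have "Measurable.pred N (\<lambda>w. \<exists>a\<in>D. \<forall>i\<in>I. a \<bullet> X i w > 0)"
    using D(1) I by measurable
  then show ?thesis by (simp add: eq pred_def)
qed

section \<open>Solution of the recursion\<close>

lemma B_coeff_negative: "k < 0 \<Longrightarrow> B_coeff n k = 0"
  by (simp add: B_coeff_def)

text \<open>The new factor is t + (2n + 1). Integer indices cover \<open>k = 0\<close> as well,
  where \<open>B_coeff n (- 1)\<close> is zero.\<close>

lemma B_coeff_Suc: "B_coeff (Suc n) k = (2 * n + 1) * B_coeff n k + B_coeff n (k - 1)"
proof -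
  define P where "P = (\<Prod>j\<in>{1..n}. [: real (2 * j - 1), 1 :])"
  have prod: "(\<Prod>j\<in>{1..Suc n}. [: real (2 * j - 1), 1 :]) = P * [:2 * n + 1, 1:]"
    by (simp add: P_def)
  have "coeff (P * [:2 * n + 1, 1:]) m = (2 * n + 1) * coeff P m + (if m = 0 then 0 else coeff P (m - 1))" for m
    by (cases m) (auto simp: mult.commute[of P] coeff_pCons)
  moreover have "B_coeff n j = (if j < 0 then 0 else coeff P (nat j))" for j
    by (simp only: B_coeff_def P_def)
  moreover have "B_coeff (Suc n) k = (if k < 0 then 0 else coeff (P * [:2 * n + 1, 1:]) (nat k))"
    unfolding B_coeff_def prod ..
  ultimately show ?thesis
    by (simp add: nat_diff_distrib del: mult_pCons_right)
qed

text \<open>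
  The upper limit may be any \<open>m \<ge> c / 2\<close>, since the extra terms vanish; this lets the recursion use the
  same limit for \<open>c\<close> and \<open>c - 1\<close>.
\<close>

lemma num_avoid_eq:
  assumes "n \<ge> 1" "c \<le> 2 * m"
  shows "num_avoid n c = 2 * (\<Sum>k=1..m. B_coeff n (int c - 2 * int k + 1))"
  using assms
proof (induction n arbitrary: c m rule: nat_induct_at_least)
  case base
  have b: "B_coeff 1 k = (if k = 0 \<or> k = 1 then 1 else 0)" for k
    by (auto simp: B_coeff_def coeff_pCons split: nat.splits)
  show ?case
  proof (cases c)
    case 0
    then show ?thesis by (auto intro!: sum.neutral simp: b[simplified])
  next
    case (Suc c')
    \<comment> \<open>Exactly one index in the sum is 0 or 1; its position
      \<open>(c + 1) div 2\<close> lies in \<open>{1..m}\<close> as \<open>c\<close> is positive and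
      at most \<open>2 * m\<close>.\<close>
    have iff: "(int c - 2 * int k + 1 = 0 \<or> int c - 2 * int k + 1 = 1) \<longleftrightarrow> k = (c + 1) div 2" for k
      by linarith
    have "(\<Sum>k=1..m. B_coeff 1 (int c - 2 * int k + 1)) = (\<Sum>k=1..m. if k = (c + 1) div 2 then 1 else 0)"
      by (intro sum.cong refl) (simp only: b iff)
    also have "\<dots> = 1"
      unfolding sum.delta[OF finite_atLeastAtMost] using base Suc by auto
    finally show ?thesis using Suc by simp
  qed
next
  case (Suc n)
  show ?case
  proof (cases c)
    case 0
    then show ?thesis by (auto intro!: sum.neutral simp: B_coeff_negative)
  next
    case (Suc c')
    have "num_avoid (Suc n) c = num_avoid n c' + (2 * n + 1) * num_avoid n c" by (simp add: Suc)
    also have "\<dots> = 2 * (\<Sum>k=1..m. B_coeff n (int c' - 2 * int k + 1))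
        + (2 * n + 1) * (2 * (\<Sum>k=1..m. B_coeff n (int c - 2 * int k + 1)))"
      using Suc.IH[of c' m] Suc.IH[of c m] Suc.prems Suc by simp
    also have "\<dots> = 2 * (\<Sum>k=1..m. B_coeff (Suc n) (int c - 2 * int k + 1))"
      unfolding B_coeff_Suc sum.distrib by (simp add: Suc sum_distrib_left algebra_simps)
    finally show ?thesis .
  qed
qed

section \<open>The random walk\<close>

lemma (in prob_space) indep_vars_reindex_inj:
  assumes "inj_on \<sigma> I" "indep_vars N X (\<sigma> ` I)"
  shows "indep_vars (\<lambda>i. N (\<sigma> i)) (\<lambda>i. X (\<sigma> i)) I"
  unfolding indep_vars_def2
proof (intro conjI ballI indep_setsI)
  let ?F = "\<lambda>i. {X i -` A \<inter> space M |A. A \<in> sets (N i)}"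
  have X: "\<And>i. i \<in> \<sigma> ` I \<Longrightarrow> random_variable (N i) (X i)" and ind: "indep_sets ?F (\<sigma> ` I)"
    using assms(2) by (auto simp: indep_vars_def2)
  show "random_variable (N (\<sigma> i)) (X (\<sigma> i))" if "i \<in> I" for i
    using X that by simp
  show "?F (\<sigma> i) \<subseteq> events" if "i \<in> I" for i
    using measurable_sets[OF X, of "\<sigma> i"] that by blast
  fix A J assume J: "J \<noteq> {}" "J \<subseteq> I" "finite J" and A: "\<forall>j\<in>J. A j \<in> ?F (\<sigma> j)"
  define \<tau> where "\<tau> = inv_into J \<sigma>"
  have inj: "inj_on \<sigma> J" using assms(1) J(2) by (rule inj_on_subset)
  have \<tau>: "\<tau> (\<sigma> j) = j" if "j \<in> J" for j using that inj by (simp add: \<tau>_def)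
  have "prob (\<Inter>i\<in>\<sigma> ` J. A (\<tau> i)) = (\<Prod>i\<in>\<sigma> ` J. prob (A (\<tau> i)))"
  proof (rule indep_setsD[OF ind])
    show "\<forall>i\<in>\<sigma> ` J. A (\<tau> i) \<in> ?F i" unfolding ball_simps using A \<tau> by simp
  qed (use J in auto)
  moreover have "(\<Inter>i\<in>\<sigma> ` J. A (\<tau> i)) = (\<Inter>j\<in>J. A j)" using \<tau> by auto
  moreover have "(\<Prod>i\<in>\<sigma> ` J. prob (A (\<tau> i))) = (\<Prod>j\<in>J. prob (A j))"
    unfolding prod.reindex[OF inj] by (rule prod.cong) (simp_all add: \<tau>)
  ultimately show "prob (\<Inter>j\<in>J. A j) = (\<Prod>j\<in>J. prob (A j))" by simp
qed

section \<open>Joint laws as product measures\<close>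

lemma (in prob_space) distr_restrict_eq_PiM:
  fixes X :: "'i \<Rightarrow> 'a \<Rightarrow> 'v::euclidean_space"
  assumes "indep_vars (\<lambda>_. borel) X I" "I \<noteq> {}" "\<And>i. i \<in> I \<Longrightarrow> distr M borel (X i) = \<mu>"
  shows "distr M (PiM I (\<lambda>_. borel)) (\<lambda>\<omega>. \<lambda>i\<in>I. X i \<omega>) = PiM I (\<lambda>_. \<mu>)"
proof -
  have rv: "random_variable borel (X i)" if "i \<in> I" for i
    using assms(1) that by (simp add: indep_vars_def2)
  have "distr M (PiM I (\<lambda>_. borel)) (\<lambda>\<omega>. \<lambda>i\<in>I. X i \<omega>) = PiM I (\<lambda>i. distr M borel (X i))"
    using indep_vars_iff_distr_eq_PiM'[of I X "\<lambda>_. borel", OF assms(2) rv] assms(1) by simp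
  also have "\<dots> = PiM I (\<lambda>_. \<mu>)" by (rule PiM_cong) (simp_all add: assms(3))
  finally show ?thesis .
qed

text \<open>The right-hand side depends only on the common law \<open>\<mu>\<close>, so any two
  independent families with this law give \<open>P\<close> the same probability. \<open>P\<close>
  looks only at coordinates in \<open>I\<close>, hence may be evaluated on restricted
  functions.\<close>

lemma (in prob_space) prob_eq_PiM:
  fixes X :: "'i \<Rightarrow> 'a \<Rightarrow> 'v::euclidean_space"
  assumes "indep_vars (\<lambda>_. borel) X I" "I \<noteq> {}" "\<And>i. i \<in> I \<Longrightarrow> distr M borel (X i) = \<mu>"
    and A: "{x \<in> space (PiM I (\<lambda>_. borel)). P x} \<in> sets (PiM I (\<lambda>_. borel))"
    and P: "\<And>x y. (\<And>i. i \<in> I \<Longrightarrow> x i = y i) \<Longrightarrow> P x = P y"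
  shows "prob {\<omega> \<in> space M. P (\<lambda>i. X i \<omega>)} = measure (PiM I (\<lambda>_. \<mu>)) {x \<in> space (PiM I (\<lambda>_. borel)). P x}"
proof -
  have [measurable]: "\<And>i. i \<in> I \<Longrightarrow> random_variable borel (X i)" using assms(1) by (auto simp: indep_vars_def2)
  have meas: "(\<lambda>\<omega>. \<lambda>i\<in>I. X i \<omega>) \<in> measurable M (PiM I (\<lambda>_. borel))" by measurable
  have "{\<omega> \<in> space M. P (\<lambda>i. X i \<omega>)} =
      (\<lambda>\<omega>. \<lambda>i\<in>I. X i \<omega>) -` {x \<in> space (PiM I (\<lambda>_. borel)). P x} \<inter> space M"
  proof -
    have "P (\<lambda>i. X i \<omega>) = P (\<lambda>i\<in>I. X i \<omega>)" for \<omega> by (rule P) simp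
    then show ?thesis using measurable_space[OF meas] by blast
  qed
  moreover have "distr M (PiM I (\<lambda>_. borel)) (\<lambda>\<omega>. \<lambda>i\<in>I. X i \<omega>) = PiM I (\<lambda>_. \<mu>)"
    by (rule distr_restrict_eq_PiM) (fact assms)+
  ultimately show ?thesis using measure_distr[OF meas A] by simp
qed

theorem theorem1p1:
  fixes M :: "'a measure" and \<xi> :: "nat \<Rightarrow> 'a \<Rightarrow> real ^ 'd" and n :: nat
  assumes "prob_space M"
    and "n \<ge> 1"
    and rv: "\<And>i. i \<in> {1..n} \<Longrightarrow> \<xi> i \<in> borel_measurable M"
    and indep: "prob_space.indep_vars M (\<lambda>_. borel) \<xi> {1..n}"
    and iid: "\<And>i. i \<in> {1..n} \<Longrightarrow> distr M borel (\<xi> i) = distr M borel (\<xi> 1)"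
    and symm: "distr M borel (\<lambda>\<omega>. - \<xi> 1 \<omega>) = distr M borel (\<xi> 1)"
    and hyp: "\<And>a b. a \<noteq> 0 \<Longrightarrow> measure M {\<omega> \<in> space M. a \<bullet> \<xi> 1 \<omega> = b} = 0"
  shows "measure M {\<omega> \<in> space M.
            (0::real^'d) \<notin> convex hull ((\<lambda>k. \<Sum>i\<in>{1..k}. \<xi> i \<omega>) ` {1..n})}
         = 2 / (2 ^ n * fact n) *
           (\<Sum>k\<in>{1..nat \<lceil>real CARD('d) / 2\<rceil>}. B_coeff n (int CARD('d) - 2 * int k + 1))"
proof -
  interpret prob_space M by fact
  define I where "I = {1..n}"
  define js where "js = [1..<Suc n]"
  define \<mu> where "\<mu> = distr M borel (\<xi> 1)"
  define P where "P x \<longleftrightarrow> 0 \<notin> convex hull ((\<lambda>k. \<Sum>i\<in>{1..k}. x i) ` {1..n})" for x :: "nat \<Rightarrow> real ^ 'd"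
  define p where "p = prob {\<omega> \<in> space M. P (\<lambda>i. \<xi> i \<omega>)}"
  have js: "set js = I" "distinct js" "length js = n" by (auto simp: js_def I_def)
  have "1 \<in> I" using assms(2) by (simp add: I_def)
  then have "I \<noteq> {}" by blast
  have rv1 [measurable]: "random_variable borel (\<xi> 1)" using rv \<open>1 \<in> I\<close> by (simp add: I_def)
  have indep_I: "indep_vars (\<lambda>_. borel) \<xi> I" using indep by (simp add: I_def)
  have law: "distr M borel (\<xi> i) = \<mu>" if "i \<in> I" for i using iid[of i] that unfolding I_def \<mu>_def .
  have P_cong: "P x = P y" if "\<And>i. i \<in> I \<Longrightarrow> x i = y i" for x y
  proof -
    have "(\<lambda>k. \<Sum>i\<in>{1..k}. x i) ` {1..n} = (\<lambda>k. \<Sum>i\<in>{1..k}. y i) ` {1..n}"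
      using that by (intro image_cong sum.cong) (auto simp: I_def)
    then show ?thesis by (simp only: P_def)
  qed
  have P_meas: "{x \<in> space (PiM I (\<lambda>_. borel)). P x} \<in> sets (PiM I (\<lambda>_. borel))"
  proof -
    have "(\<lambda>x. \<Sum>i\<in>{1..k}. x i) \<in> borel_measurable (PiM I (\<lambda>_. borel :: (real ^ 'd) measure))" if "k \<in> {1..n}" for k
      using that by (intro borel_measurable_sum measurable_component_singleton) (auto simp: I_def)
    then show ?thesis unfolding P_def by (intro sets_zero_notin_convex_hull) auto
  qed
  have p_eq: "p = measure (PiM I (\<lambda>_. \<mu>)) {x \<in> space (PiM I (\<lambda>_. borel)). P x}"
    unfolding p_def by (rule prob_eq_PiM[OF indep_I \<open>I \<noteq> {}\<close> law P_meas]) (assumption, rule P_cong, blast)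
  obtain L :: "(real \<times> nat) list list" where
    L: "\<And>(X :: nat \<Rightarrow> real ^ 'd) F. signed_perm_sum F (map X js) =
        (\<Sum>ps\<leftarrow>L. F (map (\<lambda>(s, j). s *\<^sub>R X j) ps))" and
    L_perm: "\<And>ps. ps \<in> set L \<Longrightarrow> distinct (map snd ps) \<and> set (map snd ps) = set js \<and>
        fst ` set ps \<subseteq> {1, -1}"
    using signed_perm_sum_eq_sum_list[OF js(2)] by metis
  \<comment> \<open>Summing the constant 1 counts \<open>L\<close>.\<close>
  have len_L: "real (length L) = 2 ^ n * fact n"
    using signed_perm_sum_const[of 1 "map (\<lambda>_. 0 :: real ^ 'd) js"] L[of "\<lambda>_. 1" "\<lambda>_. 0"]
    by (simp add: sum_list_triv js(3))
  define E where "E ps = {\<omega> \<in> space M. \<not> meets {0} (map (\<lambda>(s, j). s *\<^sub>R \<xi> j \<omega>) ps)}" for ps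
  \<comment> \<open>A signed permutation of the steps is again independent with law
    \<open>\<mu>\<close>, so its walk avoids 0 with the same probability \<open>p\<close>.\<close>
  have E: "E ps \<in> events" "prob (E ps) = p" if ps: "ps \<in> set L" for ps
  proof -
    \<comment> \<open>List positions start at 0 and walk steps at 1, hence
      \<open>k - 1\<close>.\<close>
    define s where "s k = fst (ps ! (k - 1))" for k
    define \<sigma> where "\<sigma> k = snd (ps ! (k - 1))" for k
    have len: "length ps = n"
      using L_perm[OF ps] js by (metis distinct_card length_map)
    have map_eq: "map (\<lambda>(s, j). s *\<^sub>R \<xi> j \<omega>) ps = map (\<lambda>k. s k *\<^sub>R \<xi> (\<sigma> k) \<omega>) [1..<Suc n]" for \<omega>
      by (intro nth_equalityI) (auto simp: len s_def \<sigma>_def case_prod_unfold simp del: upt_Suc)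
    have inj: "inj_on \<sigma> I"
      using L_perm[OF ps] unfolding I_def
      by (auto simp: inj_on_def \<sigma>_def len distinct_conv_nth)
        (metis One_nat_def Suc_pred' len le_eq_less_or_eq less_Suc_eq_le nat_neq_iff not_less_eq_eq Suc_le_lessD)
    have image: "\<sigma> ` I = I"
    proof (rule endo_inj_surj[OF _ _ inj])
      show "\<sigma> ` I \<subseteq> I"
      proof
        fix j assume "j \<in> \<sigma> ` I"
        then have "j \<in> set (map snd ps)"
          by (auto simp: \<sigma>_def I_def len intro!: imageI nth_mem)
        then show "j \<in> I" using L_perm[OF ps] js by simp
      qed
    qed (simp add: I_def)
    have s: "s k = 1 \<or> s k = -1" if "k \<in> I" for k
      using L_perm[OF ps] that nth_mem[of "k - 1" ps] by (force simp: s_def I_def len)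
    define \<eta> where "\<eta> k \<omega> = s k *\<^sub>R \<xi> (\<sigma> k) \<omega>" for k \<omega>
    have indep_\<eta>: "indep_vars (\<lambda>_. borel) \<eta> I"
    proof -
      have "indep_vars (\<lambda>_. borel) (\<lambda>k. \<xi> (\<sigma> k)) I"
        using indep_vars_reindex_inj[OF inj, of "\<lambda>_. borel" \<xi>] indep_I by (simp add: image)
      then show ?thesis unfolding \<eta>_def
        by (rule indep_vars_compose2[where Y="\<lambda>k x. s k *\<^sub>R x"]) simp
    qed
    have law_\<eta>: "distr M borel (\<eta> k) = \<mu>" if "k \<in> I" for k
    proof -
      have k: "\<sigma> k \<in> I" using image that by blast
      then have [measurable]: "random_variable borel (\<xi> (\<sigma> k))" using rv by (simp add: I_def)
      have "distr M borel (\<lambda>\<omega>. c *\<^sub>R \<xi> (\<sigma> k) \<omega>) = distr \<mu> borel (\<lambda>x. c *\<^sub>R x)" for c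
        unfolding law[OF k, symmetric] by (subst distr_distr) (auto simp: comp_def)
      moreover have "distr \<mu> borel (\<lambda>x. -1 *\<^sub>R x) = \<mu>"
        unfolding \<mu>_def by (subst distr_distr) (use rv1 symm in \<open>simp_all add: comp_def\<close>)
      moreover have "distr \<mu> borel (\<lambda>x. 1 *\<^sub>R x) = \<mu>"
        by (simp add: \<mu>_def distr_id2)
      ultimately show ?thesis using s[OF that] unfolding \<eta>_def by metis
    qed
    have E_eq: "E ps = {\<omega> \<in> space M. P (\<lambda>k. \<eta> k \<omega>)}"
      unfolding E_def P_def map_eq zero_in_convex_hull_prefix_sums \<eta>_def ..
    show "prob (E ps) = p"
      unfolding E_eq p_eq by (rule prob_eq_PiM[OF indep_\<eta> \<open>I \<noteq> {}\<close> law_\<eta> P_meas]) (assumption, rule P_cong, blast)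
    have "random_variable borel (\<eta> k)" if "k \<in> I" for k
      using indep_\<eta> that by (auto simp: indep_vars_def2)
    then have "(\<lambda>\<omega>. \<Sum>i\<in>{1..k}. \<eta> i \<omega>) \<in> borel_measurable M" if "k \<in> {1..n}" for k
      using that by (intro borel_measurable_sum) (auto simp: I_def)
    then show "E ps \<in> events"
      unfolding E_eq P_def by (intro sets_zero_notin_convex_hull) auto
  qed
  have null: "AE y in \<mu>. a \<bullet> y \<noteq> b" if "a \<noteq> 0" for a b
  proof -
    have "{\<omega> \<in> space M. a \<bullet> \<xi> 1 \<omega> = b} \<in> events" by measurable
    then have "AE \<omega> in M. a \<bullet> \<xi> 1 \<omega> \<noteq> b"
      using hyp[OF that, of b] by (intro AE_I'[of "{\<omega> \<in> space M. a \<bullet> \<xi> 1 \<omega> = b}"])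
        (auto simp: null_sets_def emeasure_eq_measure)
    then show ?thesis unfolding \<mu>_def by (subst AE_distr_iff[OF rv1]) auto
  qed
  have "prob_space \<mu>" unfolding \<mu>_def by (rule prob_space_distr) measurable
  then have "AE x in PiM I (\<lambda>_. \<mu>). generic [] (map (\<lambda>j. x j + 0) js)"
    using AE_generic[OF _ _ null js(2), of "[]" "\<lambda>_. 0"] unfolding js(1) by (simp add: \<mu>_def)
  moreover have law_vec: "distr M (PiM I (\<lambda>_. borel)) (\<lambda>\<omega>. \<lambda>i\<in>I. \<xi> i \<omega>) = PiM I (\<lambda>_. \<mu>)"
    by (rule distr_restrict_eq_PiM[OF indep_I \<open>I \<noteq> {}\<close>]) (rule law)
  ultimately have "AE x in distr M (PiM I (\<lambda>_. borel)) (\<lambda>\<omega>. \<lambda>i\<in>I. \<xi> i \<omega>). generic [] (map x js)"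
    unfolding law_vec by simp
  moreover have "(\<lambda>\<omega>. \<lambda>i\<in>I. \<xi> i \<omega>) \<in> measurable M (PiM I (\<lambda>_. borel))"
    using rv by (intro measurable_restrict) (auto simp: I_def)
  ultimately have "AE \<omega> in M. generic [] (map (\<lambda>i\<in>I. \<xi> i \<omega>) js)"
    by (rule AE_distrD[rotated])
  \<comment> \<open>The number of signed permutations avoiding 0 is almost surely constant, so it
    equals its expectation, which by linearity is \<open>length L\<close> times
    \<open>p\<close>.\<close>
  then have "AE \<omega> in M. (\<Sum>ps\<leftarrow>L. indicator (E ps) \<omega>) = num_avoid n CARD('d)"
    using AE_space
  proof eventually_elim
    case (elim \<omega>)
    have restr: "map (\<lambda>i\<in>I. \<xi> i \<omega>) js = map (\<lambda>i. \<xi> i \<omega>) js" using js by auto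
    have "signed_perm_sum (\<lambda>ys. of_bool (\<not> meets {0} ys)) (map (\<lambda>i. \<xi> i \<omega>) js) = num_avoid n CARD('d)"
      using signed_perm_sum_not_meets[of "[]" "map (\<lambda>i. \<xi> i \<omega>) js"] elim(1)[unfolded restr] js
      by (simp add: orth_list_def)
    then show ?case using elim(2) by (simp add: L E_def indicator_def of_bool_def)
  qed
  then have "expectation (\<lambda>\<omega>. \<Sum>ps\<leftarrow>L. indicator (E ps) \<omega>) = expectation (\<lambda>_. num_avoid n CARD('d))"
    using E(1) by (intro integral_cong_AE) (auto simp: sum_list_sum_nth)
  moreover have "expectation (\<lambda>\<omega>. \<Sum>ps\<leftarrow>L. indicator (E ps) \<omega>) = (\<Sum>ps\<leftarrow>L. prob (E ps))"
  proof -
    have ev: "E (L ! i) \<in> events" if "i < length L" for i using E(1) that by simp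
    have "E (L ! i) \<inter> space M = E (L ! i)" for i by (auto simp: E_def)
    then show ?thesis
      by (simp add: sum_list_sum_nth ev Bochner_Integration.integral_sum less_top[symmetric])
  qed
  ultimately have "num_avoid n CARD('d) = (\<Sum>ps\<leftarrow>L. prob (E ps))"
    by (simp add: prob_space)
  also have "\<dots> = 2 ^ n * fact n * p"
    using E(2) by (simp add: sum_list_triv len_L cong: map_cong)
  finally have "2 ^ n * fact n * p = num_avoid n CARD('d)" ..
  also have "\<dots> = 2 * (\<Sum>k\<in>{1..nat \<lceil>real CARD('d) / 2\<rceil>}. B_coeff n (int CARD('d) - 2 * int k + 1))"
  proof (rule num_avoid_eq)
    have "real CARD('d) \<le> 2 * real_of_int \<lceil>real CARD('d) / 2\<rceil>" by linarith
    then show "CARD('d) \<le> 2 * nat \<lceil>real CARD('d) / 2\<rceil>" by linarith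
  qed fact
  finally show ?thesis unfolding p_def P_def by (simp add: field_simps)
qed

end
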